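(* Consider the nonlinear descriptor system (S), its transformed coefficient matrices $E_1,\Phi,B_1,D_{11},D_{12},D_\xi,F_1,C_{12},S_{11},P_1,P_2,Q$, and the candidate filter (O), all as described in the context. Suppose $g$ satisfies the incremental quadratic constraint ($\delta$QC) and the coefficient matrices satisfy $\operatorname{rank}(\Psi)=\operatorname{rank}(\Omega)$. Suppose further that: 1) the matrices $N$, $T$, $L$, $\bar M$ (the last one determining $M$) satisfy $$T\Phi-LC_{12}-NTE_1=0,\qquad TE_1+\bar M C_{12}-S_{11}=0,\qquad TD_{12}=0;$$ 2) for every solution of (S) and corresponding solution of (O), the vectors $e_1(t)=TE_1x(t)-w(t)$ and $e(t)=z(t)-\hat z(t)$ satisfy the system $$\dot e_1(t)=Ne_1(t)+TD_\xi\,\xi(t)+TF_1\,\Delta g,\qquad e(t)=QR\,e_1(t),$$ where $\Delta g=g(Hz,t)-g(H\hat z,t)$, in such a way that (2a) when $\xi\equiv 0$, the estimation error $e(t)$ tends asymptotically to zero; (2b) when $\xi\not\equiv0$, there exists a scalar $\beta\ge0$ such that, for a prescribed disturbance attenuation level $\gamma>0$, $\|e\|_2^2<\gamma^2\|\xi\|_2^2+\beta$. Then (O) is a functional $\mathscr H_\infty$ filter for (S).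
   Context: **System (S).** $$E\dot x=Ax+Bu+Dv+\bar D_\xi\xi+Fg(HKx,t),\quad \tilde y=Cx+Gv,\quad z=Kx,$$ with real constant matrices $E,A\in\mathbb R^{m\times n}$, $B\in\mathbb R^{m\times k}$, $C\in\mathbb R^{r\times n}$, $D\in\mathbb R^{m\times q}$, $\bar D_\xi\in\mathbb R^{m\times s}$, $F\in\mathbb R^{m\times l}$, $G\in\mathbb R^{r\times q}$, $H\in\mathbb R^{l\times p}$, $K\in\mathbb R^{p\times n}$. Here $x$ is the semistate, $u$ the known input, $v$ the unknown input, $\xi$ a disturbance of bounded energy, $\tilde y$ the measured output, $z$ the functional to be estimated. $\mathscr X\subseteq\mathbb R^p$ is open, $\mathscr X_1=H\mathscr X\subseteq\mathbb R^l$, and $g:\mathscr X_1\times\mathbb R\to\mathbb R^l$ is known and continuously differentiable. Standing assumptions: (S) admits at least one solution, and for admissible initial conditions, inputs and disturbances the functional $z(t)$ is unique (even if $x(t)$ is not). **Solutions.** For an open interval $I\subseteq\mathbb R$, a continuous tuple $(x,u,v,\xi,\tilde y,z)$ on $I$ is a solution of (S) if $x\in C^1(I;\mathbb R^n)$ and (S) holds for all $t\in I$. **Incremental quadratic constraint ($\delta$QC).** A known symmetric matrix $W=\begin{bmatrix}W_{11}&W_{12}\\ W_{12}^\top&W_{22}\end{bmatrix}$ (incremental multiplier matrix; $W_{11},W_{22}$ symmetric) is given with $$\begin{bmatrix}\zeta_1-\zeta_2\\ g(\zeta_1,t)-g(\zeta_2,t)\end{bmatrix}^\top W\begin{bmatrix}\zeta_1-\zeta_2\\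 g(\zeta_1,t)-g(\zeta_2,t)\end{bmatrix}\ge0$$ for all $\zeta_1,\zeta_2$ and $t$. **Rank condition matrices.** $$\Omega=\begin{bmatrix}E&A&0&D&0&\bar D_\xi&F\\ 0&E&A&0&D&0&0\\ 0&C&0&G&0&0&0\\ 0&0&C&0&G&0&0\\ 0&0&-K&0&0&0&0\end{bmatrix},\qquad \Psi=\begin{bmatrix}\Omega\\ \begin{bmatrix}0&K&0&0&0&0&0\end{bmatrix}\end{bmatrix}.$$ **Transformation.** Let $n_0=\operatorname{rank}[E\ \bar D_\xi\ F]\le n$ and let $P$ be a nonsingular matrix with $P[E\ \bar D_\xi\ F]=\begin{bmatrix}E_1&D_\xi&F_1\\ 0&0&0\end{bmatrix}$, where $[E_1\ D_\xi\ F_1]$ has full row rank $n_0$. Partition conformably $PA=\begin{bmatrix}A_1\\ A_2\end{bmatrix}$, $PB=\begin{bmatrix}B_1\\ B_2\end{bmatrix}$, $PD=\begin{bmatrix}D_1\\ D_2\end{bmatrix}$, and set $C_1=\begin{bmatrix}A_2\\ C\end{bmatrix}$, $G_1=\begin{bmatrix}D_2\\ G\end{bmatrix}$, $y=\begin{bmatrix}-B_2u\\ \tilde y\end{bmatrix}\in\mathbb R^{r_1}$, $r_1=m+r-n_0$. Let $q_1=\operatorname{rank}G_1$ and let $U,V$ be invertible with $UG_1V=\begin{bmatrix}\mathbb I_{q_1}&0\\ 0&0\end{bmatrix}$. Put $Uy=\begin{bmatrix}y_1\\ y_2\end{bmatrix}$, $UC_1=\begin{bmatrix}C_{11}\\ C_{12}\end{bmatrix}$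 (first blocks with $q_1$ rows), $D_1V=[D_{11}\ D_{12}]$ ($D_{11}$ with $q_1$ columns), $\Phi=A_1-D_{11}C_{11}$. **Decomposition of $K$.** If $\operatorname{rank}\begin{bmatrix}C_{12}\\ K\end{bmatrix}\ne\operatorname{rank}C_{12}+\operatorname{rank}K$: choose a permutation matrix $Q$ and matrices $S_{11},P_1,P_2$ such that $S_{11}$ has full row rank $l_1$, $\operatorname{Row}(S_{11})\cap\operatorname{Row}(C_{12})=\{0\}$, $\operatorname{Row}(S_{11})\subset\operatorname{Row}(K)$ ($\operatorname{Row}$ = row space) and $K=Q\begin{bmatrix}S_{11}\\ P_1S_{11}+P_2C_{12}\end{bmatrix}$. Otherwise: $S_{11}=K$, $Q=\mathbb I$, $P_1,P_2$ are empty and $l_1=p$. **Filter (O).** $$\dot w=Nw+TB_1u+TD_{11}y_1+Ly_2+TF_1g(H\hat z,t),\qquad \hat z=Q(Rw+My_2),$$ with $w(t)\in\mathbb R^{l_1}$, $R=\begin{bmatrix}\mathbb I_{l_1}\\ P_1\end{bmatrix}$, $M=\begin{bmatrix}\bar M\\ P_1\bar M+P_2\end{bmatrix}$, and real matrices $N,T,L,\bar M$ of compatible sizes. Since $y_1,y_2$ are linear functions of $u,\tilde y$, (O) is driven by $u$ and $\tilde y$. **Functional $\mathscr H_\infty$ filter.** (O) is a functional $\mathscr H_\infty$ filter for (S) if for every solution $(x,u,v,\xi,\tilde y,z)$ of (S) there exist $w\in C^1(I;\mathbb R^{l_1})$ and $\hat z\in C(I;\mathbb R^p)$ satisfying (O)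 for all $t\in I$, and for all such $w,\hat z$: (1) if $\xi\equiv0$, then $z(t)-\hat z(t)\to0$ as $t\to\infty$; (2) if $\xi\not\equiv0$, then $\|z-\hat z\|_2^2<\gamma^2\|\xi\|_2^2+\beta$ for some constants $\gamma>0$, $\beta\ge0$. Here $\|f\|_2^2=\int_0^{t_f}\|f(t)\|^2dt$, $t_f>0$, with $\|\cdot\|$ the Euclidean norm. Limits as $t\to\infty$ refer to solutions whose interval $I$ contains $[0,\infty)$, and $\|\cdot\|_2$ to horizons with $[0,t_f]\subset I$.
   Formalization: Condition 2 is read as also assuming that for every solution of (S) with ξ≢0 a corresponding solution of (O) exists on I; without this the claim fails, since (O) may blow up or leave the domain of g. Existence for ξ≡0 is derived from condition 1. *)

theory Defs
  imports
    "HOL-Analysis.Analysis"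
    "Jordan_Normal_Form.DL_Rank"
begin

text \<open>
  All dimensions below may depend on ranks and may be zero, so vectors and matrices are the
  carrier-based ones of \<^theory>\<open>Jordan_Normal_Form.Matrix\<close>. These carry no topology; the
  Euclidean norm, continuity and differentiability are therefore spelled out, in components
  where this is possible.
\<close>

type_synonym rvec = "real Matrix.vec"
type_synonym rmat = "real Matrix.mat"

no_notation Finite_Cartesian_Product.vec_nth (infixl \<open>$\<close> 90)

subsection \<open>Matrices\<close>

definition append_cols :: "rmat \<Rightarrow> rmat \<Rightarrow> rmat" (infixr \<open>@\<^sub>c\<close> 66) where
  "A @\<^sub>c B = four_block_mat A B (0\<^sub>m 0 (dim_col A)) (0\<^sub>m 0 (dim_col B))"

definition matrix_rank :: "rmat \<Rightarrow> nat" where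
  "matrix_rank A = vec_space.rank (dim_row A) A"

definition row_space_of :: "rmat \<Rightarrow> rvec set" where
  "row_space_of A = vec_space.row_space (dim_col A) A"

definition permutation_matrix :: "nat \<Rightarrow> rmat \<Rightarrow> bool" where
  "permutation_matrix p Q \<longleftrightarrow>
     (\<exists>\<pi>. \<pi> permutes {..<p} \<and> Q = Matrix.mat p p (\<lambda>(i, j). if i = \<pi> j then 1 else 0))"

subsection \<open>Vector-valued functions\<close>

definition vnorm :: "rvec \<Rightarrow> real" where
  "vnorm a = L2_set (\<lambda>i. a $ i) {..<dim_vec a}"

definition open_in_Rn :: "nat \<Rightarrow> rvec set \<Rightarrow> bool" where
  "open_in_Rn d X \<longleftrightarrow> X \<subseteq> carrier_vec d \<and>
     (\<forall>a\<in>X. \<exists>\<epsilon>>0. \<forall>b\<in>carrier_vec d. vnorm (b - a) < \<epsilon> \<longrightarrow> b \<in> X)"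

definition vec_continuous_on :: "nat \<Rightarrow> real set \<Rightarrow> (real \<Rightarrow> rvec) \<Rightarrow> bool" where
  "vec_continuous_on d I f \<longleftrightarrow> (\<forall>t\<in>I. f t \<in> carrier_vec d) \<and>
     (\<forall>i<d. continuous_on I (\<lambda>t. f t $ i))"

definition vec_C1_on :: "nat \<Rightarrow> real set \<Rightarrow> (real \<Rightarrow> rvec) \<Rightarrow> bool" where
  "vec_C1_on d I f \<longleftrightarrow> (\<forall>t\<in>I. f t \<in> carrier_vec d) \<and>
     (\<forall>i<d. (\<lambda>t. f t $ i) C1_differentiable_on I)"

definition vec_deriv :: "(real \<Rightarrow> rvec) \<Rightarrow> real \<Rightarrow> rvec" where
  "vec_deriv f t = Matrix.vec (dim_vec (f t)) (\<lambda>i. deriv (\<lambda>s. f s $ i) t)"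

text \<open>
  Continuous differentiability of \<open>g : Z \<times> \<real> \<rightarrow> \<real>\<^sup>b\<close> with \<open>Z \<subseteq> \<real>\<^sup>a\<close>. The set \<open>Z\<close> will be a
  linear image of an open set, hence open only relative to a subspace, so the total
  (Frechet) derivative is taken within \<open>Z \<times> \<real>\<close>; \<open>J\<close> and \<open>j\<close> are its parts with respect to
  the vector and the time argument.
\<close>

definition continuous_at_in :: "rvec set \<Rightarrow> (rvec \<Rightarrow> real \<Rightarrow> real) \<Rightarrow> rvec \<Rightarrow> real \<Rightarrow> bool" where
  "continuous_at_in Z h a t \<longleftrightarrow> (\<forall>\<epsilon>>0. \<exists>\<delta>>0. \<forall>b\<in>Z. \<forall>s.
     vnorm (b - a) + \<bar>s - t\<bar> < \<delta> \<longrightarrow> \<bar>h b s - h a t\<bar> < \<epsilon>)"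

definition C1_map :: "nat \<Rightarrow> nat \<Rightarrow> rvec set \<Rightarrow> (rvec \<Rightarrow> real \<Rightarrow> rvec) \<Rightarrow> bool" where
  "C1_map a b Z g \<longleftrightarrow> (\<forall>\<zeta>\<in>Z. \<forall>t. g \<zeta> t \<in> carrier_vec b) \<and>
     (\<exists>(J :: rvec \<Rightarrow> real \<Rightarrow> rmat) (j :: rvec \<Rightarrow> real \<Rightarrow> rvec). \<forall>\<zeta>\<in>Z. \<forall>t.
        J \<zeta> t \<in> carrier_mat b a \<and> j \<zeta> t \<in> carrier_vec b \<and>
        (\<forall>i<b. \<forall>k<a. continuous_at_in Z (\<lambda>\<eta> s. J \<eta> s $$ (i, k)) \<zeta> t) \<and>
        (\<forall>i<b. continuous_at_in Z (\<lambda>\<eta> s. j \<eta> s $ i) \<zeta> t) \<and>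
        (\<forall>\<epsilon>>0. \<exists>\<delta>>0. \<forall>\<eta>\<in>Z. \<forall>s. vnorm (\<eta> - \<zeta>) + \<bar>s - t\<bar> < \<delta> \<longrightarrow>
           vnorm (g \<eta> s - g \<zeta> t - (J \<zeta> t *\<^sub>v (\<eta> - \<zeta>) + (s - t) \<cdot>\<^sub>v j \<zeta> t))
             \<le> \<epsilon> * (vnorm (\<eta> - \<zeta>) + \<bar>s - t\<bar>)))"

definition energy :: "(real \<Rightarrow> rvec) \<Rightarrow> real \<Rightarrow> real" where
  "energy f t\<^sub>f = integral {0..t\<^sub>f} (\<lambda>t. (vnorm (f t))\<^sup>2)"

subsection \<open>The descriptor system\<close>

text \<open>
  The nonlinearity is only meaningful on the image of the set \<open>sX\<close> under \<open>sH\<close>; as functions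
  are total here, membership of its argument in that image is part of being a solution,
  both of the system and of the filter.
\<close>

record descriptor_system =
  sE :: rmat
  sA :: rmat
  sB :: rmat
  sC :: rmat
  sD :: rmat
  sDxi :: rmat
  sF :: rmat
  sG :: rmat
  sH :: rmat
  sK :: rmat
  sX :: "rvec set"
  sg :: "rvec \<Rightarrow> real \<Rightarrow> rvec"

definition nonlin_domain :: "descriptor_system \<Rightarrow> rvec set" where
  "nonlin_domain S = (\<lambda>a. sH S *\<^sub>v a) ` sX S"

definition system_solution ::
  "descriptor_system \<Rightarrow> real set \<Rightarrow> (real \<Rightarrow> rvec) \<Rightarrow> (real \<Rightarrow> rvec) \<Rightarrow> (real \<Rightarrow> rvec) \<Rightarrow>
   (real \<Rightarrow> rvec) \<Rightarrow> (real \<Rightarrow> rvec) \<Rightarrow> (real \<Rightarrow> rvec) \<Rightarrow> bool" where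
  "system_solution S I x u v \<xi> y z \<longleftrightarrow>
     open I \<and> is_interval I \<and> I \<noteq> {} \<and>
     vec_C1_on (dim_col (sE S)) I x \<and>
     vec_continuous_on (dim_col (sB S)) I u \<and>
     vec_continuous_on (dim_col (sD S)) I v \<and>
     vec_continuous_on (dim_col (sDxi S)) I \<xi> \<and>
     vec_continuous_on (dim_row (sC S)) I y \<and>
     vec_continuous_on (dim_row (sK S)) I z \<and>
     (\<forall>t\<in>I.
        sH S *\<^sub>v (sK S *\<^sub>v x t) \<in> nonlin_domain S \<and>
        sE S *\<^sub>v vec_deriv x t =
          sA S *\<^sub>v x t + sB S *\<^sub>v u t + sD S *\<^sub>v v t + sDxi S *\<^sub>v \<xi> t
          + sF S *\<^sub>v sg S (sH S *\<^sub>v (sK S *\<^sub>v x t)) t \<and>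
        y t = sC S *\<^sub>v x t + sG S *\<^sub>v v t \<and>
        z t = sK S *\<^sub>v x t)"

definition functional_unique :: "descriptor_system \<Rightarrow> bool" where
  "functional_unique S \<longleftrightarrow>
     (\<forall>I t\<^sub>0 x x' u v \<xi> y y' z z'.
        system_solution S I x u v \<xi> y z \<and> system_solution S I x' u v \<xi> y' z' \<and>
        t\<^sub>0 \<in> I \<and> x t\<^sub>0 = x' t\<^sub>0 \<longrightarrow> (\<forall>t\<in>I. t \<ge> t\<^sub>0 \<longrightarrow> z t = z' t))"

definition incremental_QC :: "(rvec \<Rightarrow> real \<Rightarrow> rvec) \<Rightarrow> rvec set \<Rightarrow> rmat \<Rightarrow> bool" where
  "incremental_QC g Z W \<longleftrightarrow>
     (\<forall>\<zeta>\<^sub>1\<in>Z. \<forall>\<zeta>\<^sub>2\<in>Z. \<forall>t.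
        let d = (\<zeta>\<^sub>1 - \<zeta>\<^sub>2) @\<^sub>v (g \<zeta>\<^sub>1 t - g \<zeta>\<^sub>2 t)
        in scalar_prod d (W *\<^sub>v d) \<ge> 0)"

definition Omega_mat :: "descriptor_system \<Rightarrow> rmat" where
  "Omega_mat S =
    (let m = dim_row (sE S); n = dim_col (sE S); q = dim_col (sD S); s = dim_col (sDxi S);
         l = dim_col (sF S); r = dim_row (sC S); p = dim_row (sK S)
     in (sE S    @\<^sub>c sA S    @\<^sub>c 0\<^sub>m m n     @\<^sub>c sD S    @\<^sub>c 0\<^sub>m m q @\<^sub>c sDxi S  @\<^sub>c sF S) @\<^sub>r
        (0\<^sub>m m n @\<^sub>c sE S    @\<^sub>c sA S       @\<^sub>c 0\<^sub>m m q @\<^sub>c sD S    @\<^sub>c 0\<^sub>m m s @\<^sub>c 0\<^sub>m m l) @\<^sub>r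
        (0\<^sub>m r n @\<^sub>c sC S    @\<^sub>c 0\<^sub>m r n     @\<^sub>c sG S    @\<^sub>c 0\<^sub>m r q @\<^sub>c 0\<^sub>m r s @\<^sub>c 0\<^sub>m r l) @\<^sub>r
        (0\<^sub>m r n @\<^sub>c 0\<^sub>m r n @\<^sub>c sC S       @\<^sub>c 0\<^sub>m r q @\<^sub>c sG S    @\<^sub>c 0\<^sub>m r s @\<^sub>c 0\<^sub>m r l) @\<^sub>r
        (0\<^sub>m p n @\<^sub>c 0\<^sub>m p n @\<^sub>c (- sK S)   @\<^sub>c 0\<^sub>m p q @\<^sub>c 0\<^sub>m p q @\<^sub>c 0\<^sub>m p s @\<^sub>c 0\<^sub>m p l))"

definition Psi_mat :: "descriptor_system \<Rightarrow> rmat" where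
  "Psi_mat S =
    (let n = dim_col (sE S); q = dim_col (sD S); s = dim_col (sDxi S);
         l = dim_col (sF S); p = dim_row (sK S)
     in Omega_mat S @\<^sub>r
        (0\<^sub>m p n @\<^sub>c sK S @\<^sub>c 0\<^sub>m p n @\<^sub>c 0\<^sub>m p q @\<^sub>c 0\<^sub>m p q @\<^sub>c 0\<^sub>m p s @\<^sub>c 0\<^sub>m p l))"

subsection \<open>The filter\<close>

record filter_data =
  fN :: rmat
  fT :: rmat
  fL :: rmat
  fMbar :: rmat
  fB1 :: rmat
  fB2 :: rmat
  fD11 :: rmat
  fF1 :: rmat
  fU :: rmat
  fQ :: rmat
  fP1 :: rmat
  fP2 :: rmat

definition R_mat :: "filter_data \<Rightarrow> rmat" where
  "R_mat Fl = 1\<^sub>m (dim_row (fN Fl)) @\<^sub>r fP1 Fl"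

definition M_mat :: "filter_data \<Rightarrow> rmat" where
  "M_mat Fl = fMbar Fl @\<^sub>r (fP1 Fl * fMbar Fl + fP2 Fl)"

definition Uy :: "filter_data \<Rightarrow> rvec \<Rightarrow> rvec \<Rightarrow> rvec" where
  "Uy Fl u y = fU Fl *\<^sub>v (- (fB2 Fl *\<^sub>v u) @\<^sub>v y)"

definition y1_of :: "filter_data \<Rightarrow> rvec \<Rightarrow> rvec \<Rightarrow> rvec" where
  "y1_of Fl u y = vec_first (Uy Fl u y) (dim_col (fD11 Fl))"

definition y2_of :: "filter_data \<Rightarrow> rvec \<Rightarrow> rvec \<Rightarrow> rvec" where
  "y2_of Fl u y = vec_last (Uy Fl u y) (dim_col (fL Fl))"

definition filter_solution ::
  "descriptor_system \<Rightarrow> filter_data \<Rightarrow> real set \<Rightarrow> (real \<Rightarrow> rvec) \<Rightarrow> (real \<Rightarrow> rvec) \<Rightarrow>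
   (real \<Rightarrow> rvec) \<Rightarrow> (real \<Rightarrow> rvec) \<Rightarrow> bool" where
  "filter_solution S Fl I u y w zh \<longleftrightarrow>
     vec_C1_on (dim_row (fN Fl)) I w \<and>
     vec_continuous_on (dim_row (sK S)) I zh \<and>
     (\<forall>t\<in>I.
        sH S *\<^sub>v zh t \<in> nonlin_domain S \<and>
        vec_deriv w t =
          fN Fl *\<^sub>v w t + (fT Fl * fB1 Fl) *\<^sub>v u t + (fT Fl * fD11 Fl) *\<^sub>v y1_of Fl (u t) (y t)
          + fL Fl *\<^sub>v y2_of Fl (u t) (y t) + (fT Fl * fF1 Fl) *\<^sub>v sg S (sH S *\<^sub>v zh t) t \<and>
        zh t = fQ Fl *\<^sub>v (R_mat Fl *\<^sub>v w t + M_mat Fl *\<^sub>v y2_of Fl (u t) (y t)))"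

text \<open>Both properties refer to the half line: they are void if the time interval \<open>I\<close> of the
  solution does not contain \<open>[0, \<infinity>)\<close>, respectively for horizons with \<open>[0, t\<^sub>f]\<close> not inside \<open>I\<close>.\<close>

definition tends_to_zero :: "real set \<Rightarrow> (real \<Rightarrow> rvec) \<Rightarrow> bool" where
  "tends_to_zero I e \<longleftrightarrow> ({0..} \<subseteq> I \<longrightarrow> ((\<lambda>t. vnorm (e t)) \<longlongrightarrow> 0) at_top)"

definition attenuated :: "real set \<Rightarrow> real \<Rightarrow> real \<Rightarrow> (real \<Rightarrow> rvec) \<Rightarrow> (real \<Rightarrow> rvec) \<Rightarrow> bool" where
  "attenuated I \<gamma> \<beta> \<xi> e \<longleftrightarrow>
     (\<forall>t\<^sub>f>0. {0..t\<^sub>f} \<subseteq> I \<longrightarrow> energy e t\<^sub>f < \<gamma>\<^sup>2 * energy \<xi> t\<^sub>f + \<beta>)"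

text \<open>The attenuation level \<open>\<gamma>\<close> is a constant of the filter; \<open>\<beta>\<close> accounts for the initial
  error and may depend on the trajectory, but not on the horizon \<open>t\<^sub>f\<close>.\<close>

definition functional_Hinf_filter :: "descriptor_system \<Rightarrow> filter_data \<Rightarrow> bool" where
  "functional_Hinf_filter S Fl \<longleftrightarrow>
     (\<exists>\<gamma>>0. \<forall>I x u v \<xi> y z. system_solution S I x u v \<xi> y z \<longrightarrow>
        (\<exists>w zh. filter_solution S Fl I u y w zh) \<and>
        (\<forall>w zh. filter_solution S Fl I u y w zh \<longrightarrow>
           ((\<forall>t\<in>I. \<xi> t = 0\<^sub>v (dim_col (sDxi S))) \<longrightarrow> tends_to_zero I (\<lambda>t. z t - zh t)) \<and>
           (\<not> (\<forall>t\<in>I. \<xi> t = 0\<^sub>v (dim_col (sDxi S))) \<longrightarrow>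
              (\<exists>\<beta>\<ge>0. attenuated I \<gamma> \<beta> \<xi> (\<lambda>t. z t - zh t)))))"

end

theory Submission
  imports Defs
begin

text \<open>
  A functional \<open>H\<^sub>\<infinity>\<close> filter has to do two things along every solution of the system: possess at
  least one trajectory, and drive or attenuate the estimation error of each of its trajectories.
  The second part is exactly what condition 2 asserts, with the given \<open>\<gamma>\<close> as attenuation level. For
  \<open>\<xi>\<close> not identically zero, condition 2 also presupposes a trajectory of the filter. What has to be proved is thus that
  the filter has a trajectory when \<open>\<xi>\<close> vanishes identically.

  Such a trajectory can be written down: the error equation suggests to look for the one with
  \<open>e1 = 0\<close>, that is \<open>w = T E1 x\<close> with \<open>zh = z\<close>, and the matrix equations of condition 1 make this
  pair satisfy the filter equations:

  \<^item> Multiplication by \<open>P\<close> splits the descriptor equation into the differential part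
    \<open>E1 x' = A1 x + B1 u + D1 v + Dxi \<xi> + F1 g\<close> and the constraint \<open>-B2 u = A2 x + D2 v\<close>
    (\<open>transformed_dynamics\<close>).

  \<^item> The constraint turns the known vector \<open>(-B2 u, y)\<close> into an output \<open>C1 x + G1 v\<close>. In the
    coordinates given by \<open>U\<close> and \<open>V\<close>, with \<open>v = V (v1, v2)\<close>, it reads \<open>y1 = C11 x + v1\<close> and
    \<open>y2 = C12 x\<close> (\<open>transformed_output\<close>).

  \<^item> Hence \<open>v1\<close> is known from \<open>x\<close> and \<open>y1\<close>, while \<open>v2\<close> is annihilated by \<open>T D12 = 0\<close>. Together with
    \<open>T \<Phi> = L C12 + N T E1\<close> this gives the differential equation for \<open>w\<close> (\<open>projected_dynamics\<close>).

  \<^item> Finally \<open>T E1 + Mbar C12 = S11\<close> makes \<open>R w + M y2\<close> equal to \<open>(S11, P1 S11 + P2 C12) x\<close>, which \<open>Q\<close>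
    maps to \<open>K x = z\<close> (\<open>functional_reconstruction\<close>).
\<close>

section \<open>Differentiating linear images of vector-valued functions\<close>

lemma vec_deriv_carrier: "f t \<in> carrier_vec d \<Longrightarrow> vec_deriv f t \<in> carrier_vec d"
  by (rule carrier_vecI) (simp add: vec_deriv_def)

lemma vec_C1_on_deriv:
  assumes "vec_C1_on d I f" "t \<in> I" "i < d"
  shows "((\<lambda>s. f s $ i) has_real_derivative vec_deriv f t $ i) (at t)"
proof -
  obtain D where D: "((\<lambda>s. f s $ i) has_real_derivative D) (at t)"
    using assms unfolding vec_C1_on_def C1_differentiable_on_def
      has_real_derivative_iff_has_vector_derivative by blast
  moreover have "dim_vec (f t) = d"
    using assms by (auto simp: vec_C1_on_def)
  ultimately show ?thesis
    using DERIV_imp_deriv[OF D] \<open>i < d\<close> by (simp add: vec_deriv_def)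
qed

lemma vec_C1_on_continuous_deriv:
  assumes "vec_C1_on d I f" "i < d"
  shows "continuous_on I (\<lambda>t. vec_deriv f t $ i)"
proof -
  obtain D where D: "\<forall>t\<in>I. ((\<lambda>s. f s $ i) has_real_derivative D t) (at t)"
    and cont: "continuous_on I D"
    using assms unfolding vec_C1_on_def C1_differentiable_on_def
      has_real_derivative_iff_has_vector_derivative by blast
  have "vec_deriv f t $ i = D t" if "t \<in> I" for t
    using vec_C1_on_deriv[OF assms(1) that assms(2)] D that DERIV_unique by blast
  with cont show ?thesis
    by (simp cong: continuous_on_cong)
qed

lemma vec_C1_onI:
  assumes "\<And>t. t \<in> I \<Longrightarrow> f t \<in> carrier_vec d"
    and "\<And>t i. t \<in> I \<Longrightarrow> i < d \<Longrightarrow> ((\<lambda>s. f s $ i) has_real_derivative f' t $ i) (at t)"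
    and "\<And>i. i < d \<Longrightarrow> continuous_on I (\<lambda>t. f' t $ i)"
  shows "vec_C1_on d I f"
proof -
  have "(\<lambda>t. f t $ i) C1_differentiable_on I" if "i < d" for i
    unfolding C1_differentiable_on_def has_real_derivative_iff_has_vector_derivative[symmetric]
    using assms(2,3) that by (intro exI[of _ "\<lambda>t. f' t $ i"]) simp
  then show ?thesis
    using assms(1) by (simp add: vec_C1_on_def)
qed

lemma mult_mat_vec_index_sum:
  assumes "M \<in> carrier_mat a d" "x \<in> carrier_vec d" "i < a"
  shows "(M *\<^sub>v x) $ i = (\<Sum>j<d. M $$ (i, j) * x $ j)"
  using assms by (simp add: scalar_prod_def lessThan_atLeast0)

lemma mult_mat_vec_has_deriv:
  assumes M: "M \<in> carrier_mat a d" and f: "vec_C1_on d I f" and I: "open I" "t \<in> I" and i: "i < a"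
  shows "((\<lambda>s. (M *\<^sub>v f s) $ i) has_real_derivative (M *\<^sub>v vec_deriv f t) $ i) (at t)"
proof -
  have dim: "f s \<in> carrier_vec d" if "s \<in> I" for s
    using f that by (simp add: vec_C1_on_def)
  have sum: "((\<lambda>s. \<Sum>j<d. M $$ (i, j) * f s $ j) has_real_derivative
          (\<Sum>j<d. M $$ (i, j) * vec_deriv f t $ j)) (at t)"
    by (rule DERIV_sum, rule DERIV_cmult, rule vec_C1_on_deriv[OF f I(2)]) simp
  \<comment> \<open>the dimension of \<open>f s\<close> is known for \<open>s \<in> I\<close> only, but \<open>I\<close> is a neighbourhood of \<open>t\<close>\<close>
  have "((\<lambda>s. (M *\<^sub>v f s) $ i) has_real_derivative
      (\<Sum>j<d. M $$ (i, j) * vec_deriv f t $ j)) (at t)"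
  proof (rule has_field_derivative_transform_within_open[OF sum I])
    fix s assume "s \<in> I"
    show "(\<Sum>j<d. M $$ (i, j) * f s $ j) = (M *\<^sub>v f s) $ i"
      by (rule mult_mat_vec_index_sum[OF M dim[OF \<open>s \<in> I\<close>] i, symmetric])
  qed
  moreover have "vec_deriv f t \<in> carrier_vec d"
    by (rule vec_deriv_carrier[of f, OF dim[OF I(2)]])
  ultimately show ?thesis
    by (subst mult_mat_vec_index_sum[OF M _ i])
qed

lemma vec_C1_on_mult_mat:
  assumes M: "M \<in> carrier_mat a d" and f: "vec_C1_on d I f" and I: "open I"
  shows "vec_C1_on a I (\<lambda>t. M *\<^sub>v f t)"
proof (rule vec_C1_onI[where f' = "\<lambda>t. M *\<^sub>v vec_deriv f t"])
  fix i assume i: "i < a"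
  have "continuous_on I (\<lambda>t. \<Sum>j<d. M $$ (i, j) * vec_deriv f t $ j)"
    by (intro continuous_intros vec_C1_on_continuous_deriv[OF f]) simp
  moreover have "vec_deriv f t \<in> carrier_vec d" if "t \<in> I" for t
    using f that by (intro vec_deriv_carrier[of f]) (simp add: vec_C1_on_def)
  ultimately show "continuous_on I (\<lambda>t. (M *\<^sub>v vec_deriv f t) $ i)"
    using mult_mat_vec_index_sum[OF M _ i] by (simp cong: continuous_on_cong)
qed (use mult_mat_vec_has_deriv[OF M f I] M f in \<open>auto simp: vec_C1_on_def\<close>)

lemma vec_deriv_mult_mat:
  assumes M: "M \<in> carrier_mat a d" and f: "vec_C1_on d I f" and I: "open I" "t \<in> I"
  shows "vec_deriv (\<lambda>t. M *\<^sub>v f t) t = M *\<^sub>v vec_deriv f t"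
  using M DERIV_imp_deriv[OF mult_mat_vec_has_deriv[OF M f I]]
  by (intro eq_vecI) (auto simp: vec_deriv_def)

section \<open>Splitting the descriptor equation\<close>

lemma append_cols_mult_vec:
  assumes A: "A \<in> carrier_mat a b" and B: "B \<in> carrier_mat a c"
    and x: "x \<in> carrier_vec b" and y: "y \<in> carrier_vec c"
  shows "(A @\<^sub>c B) *\<^sub>v (x @\<^sub>v y) = A *\<^sub>v x + B *\<^sub>v y"
proof -
  have "(A @\<^sub>c B) *\<^sub>v (x @\<^sub>v y) =
      (A *\<^sub>v x + B *\<^sub>v y) @\<^sub>v (0\<^sub>m 0 b *\<^sub>v x + 0\<^sub>m 0 c *\<^sub>v y)"
    using four_block_mat_mult_vec[OF A B zero_carrier_mat zero_carrier_mat x y] A B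
    by (simp add: append_cols_def)
  then show ?thesis
    using A B by (auto intro!: eq_vecI)
qed

lemma append_cols_carrier [simp, intro]:
  "A \<in> carrier_mat a b \<Longrightarrow> B \<in> carrier_mat a c \<Longrightarrow> A @\<^sub>c B \<in> carrier_mat a (b + c)"
  unfolding append_cols_def by (rule carrier_matI) auto

text \<open>
  The hypothesis on \<open>P\<close> concerns the three matrices \<open>E\<close>, \<open>Dxib\<close>, \<open>F\<close> side by side. The equation is
  therefore brought into the form \<open>[E Dxib F] (dx, -\<xi>, -h) = A x + B u + D v\<close> before \<open>P\<close> is applied;
  the lower half of the left-hand side then vanishes, and the two halves are the two claims.
\<close>
lemma transformed_dynamics:
  assumes "E \<in> carrier_mat m n" "A \<in> carrier_mat m n" "B \<in> carrier_mat m k"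
    "D \<in> carrier_mat m q" "Dxib \<in> carrier_mat m s" "F \<in> carrier_mat m l"
    and P: "P \<in> carrier_mat m m"
    and "E1 \<in> carrier_mat n0 n" "Dxi \<in> carrier_mat n0 s" "F1 \<in> carrier_mat n0 l"
    and "A1 \<in> carrier_mat n0 n" "B1 \<in> carrier_mat n0 k" "D1 \<in> carrier_mat n0 q"
    and "A2 \<in> carrier_mat m' n" "B2 \<in> carrier_mat m' k" "D2 \<in> carrier_mat m' q"
    and PE: "P * (E @\<^sub>c Dxib @\<^sub>c F) = (E1 @\<^sub>c Dxi @\<^sub>c F1) @\<^sub>r 0\<^sub>m m' (n + s + l)"
    and PA: "P * A = A1 @\<^sub>r A2" and PB: "P * B = B1 @\<^sub>r B2" and PD: "P * D = D1 @\<^sub>r D2"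
    and "x \<in> carrier_vec n" "dx \<in> carrier_vec n" "u \<in> carrier_vec k" "v \<in> carrier_vec q"
    and "\<xi> \<in> carrier_vec s" "h \<in> carrier_vec l"
    and sys: "E *\<^sub>v dx = A *\<^sub>v x + B *\<^sub>v u + D *\<^sub>v v + Dxib *\<^sub>v \<xi> + F *\<^sub>v h"
  shows "E1 *\<^sub>v dx = A1 *\<^sub>v x + B1 *\<^sub>v u + D1 *\<^sub>v v + Dxi *\<^sub>v \<xi> + F1 *\<^sub>v h" (is ?dynamics)
    and "- (B2 *\<^sub>v u) = A2 *\<^sub>v x + D2 *\<^sub>v v" (is ?constraint)
proof -
  note car = assms(1-16) assms(21-26)
  have EDF: "E @\<^sub>c Dxib @\<^sub>c F \<in> carrier_mat m (n + (s + l))"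
    and EDF1: "E1 @\<^sub>c Dxi @\<^sub>c F1 \<in> carrier_mat n0 (n + (s + l))"
    using car by auto
  have v: "dx @\<^sub>v - \<xi> @\<^sub>v - h \<in> carrier_vec (n + (s + l))"
    using car by auto
  have "E *\<^sub>v dx + (Dxib *\<^sub>v - \<xi> + F *\<^sub>v - h) = A *\<^sub>v x + (B *\<^sub>v u + D *\<^sub>v v)"
  proof (rule eq_vecI)
    fix i assume i: "i < dim_vec (A *\<^sub>v x + (B *\<^sub>v u + D *\<^sub>v v))"
    then have "i < m" using assms(4) by auto
    then show "(E *\<^sub>v dx + (Dxib *\<^sub>v - \<xi> + F *\<^sub>v - h)) $ i =
        (A *\<^sub>v x + (B *\<^sub>v u + D *\<^sub>v v)) $ i"
      using arg_cong[OF sys, of "\<lambda>w. w $ i"] assms(1-6) assms(21-26)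
      by (auto simp: algebra_simps)
  qed (use assms in auto)
  then have "P *\<^sub>v ((E @\<^sub>c Dxib @\<^sub>c F) *\<^sub>v (dx @\<^sub>v - \<xi> @\<^sub>v - h))
      = P *\<^sub>v (A *\<^sub>v x + (B *\<^sub>v u + D *\<^sub>v v))"
    by (simp add: car append_cols_mult_vec[of _ m n _ "s + l"] append_cols_mult_vec[of _ m s _ l])
  moreover have "P *\<^sub>v ((E @\<^sub>c Dxib @\<^sub>c F) *\<^sub>v (dx @\<^sub>v - \<xi> @\<^sub>v - h))
      = (E1 *\<^sub>v dx + (Dxi *\<^sub>v - \<xi> + F1 *\<^sub>v - h)) @\<^sub>v 0\<^sub>v m'"
  proof -
    have "P *\<^sub>v ((E @\<^sub>c Dxib @\<^sub>c F) *\<^sub>v (dx @\<^sub>v - \<xi> @\<^sub>v - h))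
        = ((E1 @\<^sub>c Dxi @\<^sub>c F1) @\<^sub>r 0\<^sub>m m' (n + (s + l))) *\<^sub>v (dx @\<^sub>v - \<xi> @\<^sub>v - h)"
      using assoc_mult_mat_vec[OF P EDF v] PE by (simp add: add.assoc)
    also have "\<dots> = ((E1 @\<^sub>c Dxi @\<^sub>c F1) *\<^sub>v (dx @\<^sub>v - \<xi> @\<^sub>v - h)) @\<^sub>v
        (0\<^sub>m m' (n + (s + l)) *\<^sub>v (dx @\<^sub>v - \<xi> @\<^sub>v - h))"
      by (rule mat_mult_append[OF EDF1 zero_carrier_mat v])
    also have "0\<^sub>m m' (n + (s + l)) *\<^sub>v (dx @\<^sub>v - \<xi> @\<^sub>v - h) = 0\<^sub>v m'"
      using v by (intro eq_vecI) auto
    also have "(E1 @\<^sub>c Dxi @\<^sub>c F1) *\<^sub>v (dx @\<^sub>v - \<xi> @\<^sub>v - h)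
        = E1 *\<^sub>v dx + (Dxi *\<^sub>v - \<xi> + F1 *\<^sub>v - h)"
      by (simp add: car append_cols_mult_vec[of _ n0 n _ "s + l"] append_cols_mult_vec[of _ n0 s _ l])
    finally show ?thesis .
  qed
  moreover have "P *\<^sub>v (A *\<^sub>v x + (B *\<^sub>v u + D *\<^sub>v v))
      = (A1 *\<^sub>v x + (B1 *\<^sub>v u + D1 *\<^sub>v v)) @\<^sub>v (A2 *\<^sub>v x + (B2 *\<^sub>v u + D2 *\<^sub>v v))"
  proof -
    have "P *\<^sub>v (A *\<^sub>v x + (B *\<^sub>v u + D *\<^sub>v v))
        = (P * A) *\<^sub>v x + ((P * B) *\<^sub>v u + (P * D) *\<^sub>v v)"
      using car by (simp add: mult_add_distrib_mat_vec[OF P] assoc_mult_mat_vec[OF P])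
    also have "\<dots> = (A1 *\<^sub>v x @\<^sub>v A2 *\<^sub>v x) + ((B1 *\<^sub>v u @\<^sub>v B2 *\<^sub>v u) + (D1 *\<^sub>v v @\<^sub>v D2 *\<^sub>v v))"
      by (simp add: car PA PB PD mat_mult_append[of _ n0 n _ m'] mat_mult_append[of _ n0 k _ m']
          mat_mult_append[of _ n0 q _ m'])
    also have "\<dots> = (A1 *\<^sub>v x + (B1 *\<^sub>v u + D1 *\<^sub>v v)) @\<^sub>v (A2 *\<^sub>v x + (B2 *\<^sub>v u + D2 *\<^sub>v v))"
      by (subst append_vec_add[where n = n0 and m = m'] |
          rule mult_mat_vec_carrier add_carrier_vec append_carrier_vec assms refl)+
    finally show ?thesis .
  qed
  ultimately have
    "(E1 *\<^sub>v dx + (Dxi *\<^sub>v - \<xi> + F1 *\<^sub>v - h)) @\<^sub>v 0\<^sub>v m' =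
      (A1 *\<^sub>v x + (B1 *\<^sub>v u + D1 *\<^sub>v v)) @\<^sub>v (A2 *\<^sub>v x + (B2 *\<^sub>v u + D2 *\<^sub>v v))"
    by simp
  moreover have "E1 *\<^sub>v dx + (Dxi *\<^sub>v - \<xi> + F1 *\<^sub>v - h) \<in> carrier_vec n0"
    "A1 *\<^sub>v x + (B1 *\<^sub>v u + D1 *\<^sub>v v) \<in> carrier_vec n0"
    using car by auto
  ultimately have
    d: "E1 *\<^sub>v dx + (Dxi *\<^sub>v - \<xi> + F1 *\<^sub>v - h) = A1 *\<^sub>v x + (B1 *\<^sub>v u + D1 *\<^sub>v v)"
    and c: "0\<^sub>v m' = A2 *\<^sub>v x + (B2 *\<^sub>v u + D2 *\<^sub>v v)"
    using append_vec_eq by blast+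
  show ?dynamics
  proof (rule eq_vecI)
    fix i assume i: "i < dim_vec (A1 *\<^sub>v x + B1 *\<^sub>v u + D1 *\<^sub>v v + Dxi *\<^sub>v \<xi> + F1 *\<^sub>v h)"
    then have "i < n0" using assms(10) by auto
    then show "(E1 *\<^sub>v dx) $ i = (A1 *\<^sub>v x + B1 *\<^sub>v u + D1 *\<^sub>v v + Dxi *\<^sub>v \<xi> + F1 *\<^sub>v h) $ i"
      using arg_cong[OF d, of "\<lambda>w. w $ i"] assms(8-13) assms(21-26)
      by (auto simp: algebra_simps)
  qed (use assms in auto)
  show ?constraint
  proof (rule eq_vecI)
    fix i assume i: "i < dim_vec (A2 *\<^sub>v x + D2 *\<^sub>v v)"
    then have "i < m'" using assms(16) by auto
    then show "(- (B2 *\<^sub>v u)) $ i = (A2 *\<^sub>v x + D2 *\<^sub>v v) $ i"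
      using arg_cong[OF c, of "\<lambda>w. w $ i"] assms(14-16) assms(21-26)
      by (auto simp: algebra_simps)
  qed (use assms in auto)
qed

section \<open>Normalising the output\<close>

lemma invertible_mat_mult_vec_surj:
  assumes V: "V \<in> carrier_mat q q" "invertible_mat V" and v: "v \<in> carrier_vec q"
  obtains v' where "v' \<in> carrier_vec q" "v = V *\<^sub>v v'"
proof -
  obtain V' where inv: "V * V' = 1\<^sub>m q" and inv': "V' * V = 1\<^sub>m (dim_row V')"
    using V by (auto simp: invertible_mat_def inverts_mat_def)
  have "V' \<in> carrier_mat q q"
    using arg_cong[OF inv, of dim_col] arg_cong[OF inv', of dim_col] V by auto
  then show ?thesis
    using that[of "V' *\<^sub>v v"] V v inv by (simp flip: assoc_mult_mat_vec)
qed

text \<open>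
  The normal form of \<open>G1\<close> separates the unknown input: \<open>v1\<close> enters the upper output block without
  distortion, and \<open>v2\<close> enters neither block.
\<close>
lemma transformed_output:
  fixes C1 :: "'a :: comm_ring_1 Matrix.mat"
  assumes C1: "C1 \<in> carrier_mat r1 n" and G1: "G1 \<in> carrier_mat r1 q"
    and U: "U \<in> carrier_mat r1 r1" and V: "V \<in> carrier_mat q q"
    and UGV: "U * G1 * V = four_block_mat (1\<^sub>m a) (0\<^sub>m a b) (0\<^sub>m c a) (0\<^sub>m c b)"
    and C11: "C11 \<in> carrier_mat a n" and C12: "C12 \<in> carrier_mat c n" and UC: "U * C1 = C11 @\<^sub>r C12"
    and x: "x \<in> carrier_vec n" and v1: "v1 \<in> carrier_vec a" and v2: "v2 \<in> carrier_vec b"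
    and q: "q = a + b"
  shows "U *\<^sub>v (C1 *\<^sub>v x + G1 *\<^sub>v (V *\<^sub>v (v1 @\<^sub>v v2))) = (C11 *\<^sub>v x + v1) @\<^sub>v C12 *\<^sub>v x"
proof -
  have v: "v1 @\<^sub>v v2 \<in> carrier_vec q"
    using v1 v2 q by simp
  have "U *\<^sub>v (C1 *\<^sub>v x + G1 *\<^sub>v (V *\<^sub>v (v1 @\<^sub>v v2)))
      = (U * C1) *\<^sub>v x + (U * G1 * V) *\<^sub>v (v1 @\<^sub>v v2)"
    using U C1 G1 V v x mult_carrier_mat[OF U G1]
    by (simp add: mult_add_distrib_mat_vec[OF U] assoc_mult_mat_vec[of U r1 r1 "G1 * V" q]
        assoc_mult_mat_vec[of G1 r1 q V q] assoc_mult_mat[of U r1 r1 G1 q V q])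
  also have "\<dots> = (C11 *\<^sub>v x @\<^sub>v C12 *\<^sub>v x) + (v1 @\<^sub>v 0\<^sub>v c)"
  proof -
    have "0\<^sub>m a b *\<^sub>v v2 = 0\<^sub>v a" "0\<^sub>m c a *\<^sub>v v1 = 0\<^sub>v c" "0\<^sub>m c b *\<^sub>v v2 = 0\<^sub>v c"
      using v1 v2 by (auto intro!: eq_vecI)
    then show ?thesis
      unfolding UC UGV mat_mult_append[OF C11 C12 x]
      using four_block_mat_mult_vec[OF one_carrier_mat zero_carrier_mat zero_carrier_mat
          zero_carrier_mat v1 v2] v1 by (simp add: one_mult_mat_vec[of v1 a])
  qed
  also have "\<dots> = (C11 *\<^sub>v x + v1) @\<^sub>v C12 *\<^sub>v x"
    using append_vec_add[of "C11 *\<^sub>v x" a v1 "C12 *\<^sub>v x" c "0\<^sub>v c"] C11 C12 x v1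
    by simp
  finally show ?thesis .
qed

lemma vec_first_append: "a \<in> carrier_vec d \<Longrightarrow> vec_first (a @\<^sub>v b) d = a"
  by (intro eq_vecI) (auto simp: vec_first_def)

lemma vec_last_append: "b \<in> carrier_vec d \<Longrightarrow> vec_last (a @\<^sub>v b) d = b"
  by (intro eq_vecI) (auto simp: vec_last_def)

section \<open>The filter equations along the exact trajectory\<close>

text \<open>
  In \<open>T D1 v = T D11 v1 + T D12 v2\<close> the second term is zero, and \<open>v1 = (C11 x + v1) - C11 x\<close> expresses
  the first one by the output block \<open>C11 x + v1\<close>. The correction \<open>-T D11 C11 x\<close> combines with
  \<open>T A1 x\<close> to \<open>T \<Phi> x\<close>, to which the Sylvester-type equation applies.
\<close>
lemma projected_dynamics:
  assumes "T \<in> carrier_mat l1 n0" "N \<in> carrier_mat l1 l1" "L \<in> carrier_mat l1 c"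
    and "E1 \<in> carrier_mat n0 n" "A1 \<in> carrier_mat n0 n" "C11 \<in> carrier_mat a n" "C12 \<in> carrier_mat c n"
    and "D1 \<in> carrier_mat n0 q" "V \<in> carrier_mat q q"
    and "D11 \<in> carrier_mat n0 a" "D12 \<in> carrier_mat n0 b" and q: "q = a + b"
    and "x \<in> carrier_vec n" "f \<in> carrier_vec n0" "v1 \<in> carrier_vec a" "v2 \<in> carrier_vec b"
    and DV: "D1 * V = D11 @\<^sub>c D12"
    and sylvester: "T * (A1 - D11 * C11) - L * C12 - N * T * E1 = 0\<^sub>m l1 n"
    and decoupled: "T * D12 = 0\<^sub>m l1 b"
  shows "T *\<^sub>v (A1 *\<^sub>v x + D1 *\<^sub>v (V *\<^sub>v (v1 @\<^sub>v v2)) + f) =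
    N *\<^sub>v ((T * E1) *\<^sub>v x) + (T * D11) *\<^sub>v (C11 *\<^sub>v x + v1) + L *\<^sub>v (C12 *\<^sub>v x) + T *\<^sub>v f"
proof -
  note car = assms(1-11) assms(13-16)
  have D1v: "D1 *\<^sub>v (V *\<^sub>v (v1 @\<^sub>v v2)) = D11 *\<^sub>v v1 + D12 *\<^sub>v v2"
    using append_cols_mult_vec[of D11 n0 a D12 b v1 v2] car q
    by (simp flip: DV)
  have TD12: "T *\<^sub>v (D12 *\<^sub>v v2) = 0\<^sub>v l1"
  proof -
    have "T *\<^sub>v (D12 *\<^sub>v v2) = (T * D12) *\<^sub>v v2"
      using car by (simp add: assoc_mult_mat_vec[of T l1 n0])
    also have "\<dots> = 0\<^sub>v l1"
      using car by (auto simp: decoupled intro!: eq_vecI)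
    finally show ?thesis .
  qed
  have "0\<^sub>v l1 = 0\<^sub>m l1 n *\<^sub>v x"
    using car by (intro eq_vecI) auto
  also have "\<dots> = (T * (A1 - D11 * C11) - L * C12 - N * T * E1) *\<^sub>v x"
    by (simp only: sylvester)
  also have "\<dots> = (T * (A1 - D11 * C11)) *\<^sub>v x - (L * C12) *\<^sub>v x - (N * T * E1) *\<^sub>v x"
    by (subst minus_mult_distrib_mat_vec[where nr = l1 and nc = n] |
        rule minus_carrier_mat mult_carrier_mat car refl)+
  also have "(T * (A1 - D11 * C11)) *\<^sub>v x = T *\<^sub>v (A1 *\<^sub>v x) - T *\<^sub>v (D11 *\<^sub>v (C11 *\<^sub>v x))"
  proof -
    have "(T * (A1 - D11 * C11)) *\<^sub>v x = T *\<^sub>v ((A1 - D11 * C11) *\<^sub>v x)"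
      by (rule assoc_mult_mat_vec[of T l1 n0 _ n]) (use car in auto)
    also have "(A1 - D11 * C11) *\<^sub>v x = A1 *\<^sub>v x - D11 *\<^sub>v (C11 *\<^sub>v x)"
      using car by (simp add: minus_mult_distrib_mat_vec[of _ n0 n] assoc_mult_mat_vec[of _ n0 a])
    finally show ?thesis
      using mult_minus_distrib_mat_vec[of T l1 n0 "A1 *\<^sub>v x" "D11 *\<^sub>v (C11 *\<^sub>v x)"] car by simp
  qed
  also have "(L * C12) *\<^sub>v x = L *\<^sub>v (C12 *\<^sub>v x)"
    using car by (simp add: assoc_mult_mat_vec[of _ l1 c])
  also have "(N * T * E1) *\<^sub>v x = N *\<^sub>v ((T * E1) *\<^sub>v x)"
    using car by (simp add: assoc_mult_mat[of N l1 l1 T n0 E1 n]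
        assoc_mult_mat_vec[of N l1 l1 "T * E1" n])
  finally have syl: "0\<^sub>v l1 = T *\<^sub>v (A1 *\<^sub>v x) - T *\<^sub>v (D11 *\<^sub>v (C11 *\<^sub>v x))
      - L *\<^sub>v (C12 *\<^sub>v x) - N *\<^sub>v ((T * E1) *\<^sub>v x)" .
  have TD11: "(T * D11) *\<^sub>v (C11 *\<^sub>v x + v1) =
      T *\<^sub>v (D11 *\<^sub>v (C11 *\<^sub>v x)) + T *\<^sub>v (D11 *\<^sub>v v1)"
  proof -
    have "(T * D11) *\<^sub>v (C11 *\<^sub>v x + v1) = T *\<^sub>v (D11 *\<^sub>v (C11 *\<^sub>v x + v1))"
      by (rule assoc_mult_mat_vec) (use car in auto)
    also have "\<dots> = T *\<^sub>v (D11 *\<^sub>v (C11 *\<^sub>v x) + D11 *\<^sub>v v1)"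
      using car by (simp add: mult_add_distrib_mat_vec[of D11 n0 a])
    also have "\<dots> = T *\<^sub>v (D11 *\<^sub>v (C11 *\<^sub>v x)) + T *\<^sub>v (D11 *\<^sub>v v1)"
      by (rule mult_add_distrib_mat_vec) (use car in auto)
    finally show ?thesis .
  qed
  have lhs: "T *\<^sub>v (A1 *\<^sub>v x + D1 *\<^sub>v (V *\<^sub>v (v1 @\<^sub>v v2)) + f) =
      T *\<^sub>v (A1 *\<^sub>v x) + (T *\<^sub>v (D11 *\<^sub>v v1) + T *\<^sub>v (D12 *\<^sub>v v2)) + T *\<^sub>v f"
    unfolding D1v
    by (subst mult_add_distrib_mat_vec[where nr = l1 and nc = n0] |
        rule add_carrier_vec mult_mat_vec_carrier car refl)+
  show ?thesis
    unfolding lhs TD11 TD12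
  proof (rule eq_vecI, goal_cases)
    case (1 i)
    then have "i < l1" using car by auto
    then show ?case
      using arg_cong[OF syl, of "\<lambda>w. w $ i"] car
      by (simp del: index_mult_mat_vec assoc_mult_mat_vec)
  qed (use car in auto)
qed

text \<open>
  The first block is \<open>(X + Mbar C12) x = S11 x\<close>. The second is \<open>P1\<close> times the first one plus
  \<open>P2 C12 x\<close>, because the lower blocks of both coefficient matrices are built from \<open>P1\<close> times the
  upper ones.
\<close>
lemma functional_reconstruction:
  fixes X :: "'a :: comm_ring_1 Matrix.mat"
  assumes "S11 \<in> carrier_mat l1 n" "C12 \<in> carrier_mat c n" "X \<in> carrier_mat l1 n"
    and "Mbar \<in> carrier_mat l1 c" "P1 \<in> carrier_mat d l1" "P2 \<in> carrier_mat d c"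
    and "x \<in> carrier_vec n"
    and split: "X + Mbar * C12 = S11"
  shows "(1\<^sub>m l1 @\<^sub>r P1) *\<^sub>v (X *\<^sub>v x) + (Mbar @\<^sub>r (P1 * Mbar + P2)) *\<^sub>v (C12 *\<^sub>v x) =
    (S11 @\<^sub>r (P1 * S11 + P2 * C12)) *\<^sub>v x"
proof -
  note car = assms(1-7)
  define a where "a = X *\<^sub>v x"
  define y where "y = C12 *\<^sub>v x"
  have [simp]: "a \<in> carrier_vec l1" "y \<in> carrier_vec c"
    using car by (auto simp: a_def y_def)
  have S11x: "S11 *\<^sub>v x = a + Mbar *\<^sub>v y"
    unfolding split[symmetric] a_def y_def
    using car by (simp add: add_mult_distrib_mat_vec[of X l1 n "Mbar * C12" x]
        assoc_mult_mat_vec[of Mbar l1 c C12 n])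
  have "(1\<^sub>m l1 @\<^sub>r P1) *\<^sub>v a + (Mbar @\<^sub>r (P1 * Mbar + P2)) *\<^sub>v y
      = (a @\<^sub>v P1 *\<^sub>v a) + (Mbar *\<^sub>v y @\<^sub>v (P1 * Mbar + P2) *\<^sub>v y)"
    using mat_mult_append[of "1\<^sub>m l1" l1 l1 P1 d a]
      mat_mult_append[of Mbar l1 c "P1 * Mbar + P2" d y] car by (simp add: one_mult_mat_vec[of a l1])
  also have "\<dots> = (a + Mbar *\<^sub>v y) @\<^sub>v (P1 *\<^sub>v a + (P1 * Mbar + P2) *\<^sub>v y)"
    by (intro append_vec_add[where n = l1 and m = d] mult_mat_vec_carrier)
      (use car in auto)
  also have "P1 *\<^sub>v a + (P1 * Mbar + P2) *\<^sub>v y = (P1 * S11 + P2 * C12) *\<^sub>v x"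
  proof -
    have "(P1 * S11 + P2 * C12) *\<^sub>v x = P1 *\<^sub>v (S11 *\<^sub>v x) + P2 *\<^sub>v y"
      using car by (simp add: add_mult_distrib_mat_vec[of _ d n] assoc_mult_mat_vec[of _ d l1]
          assoc_mult_mat_vec[of _ d c] y_def)
    also have "\<dots> = P1 *\<^sub>v a + P1 *\<^sub>v (Mbar *\<^sub>v y) + P2 *\<^sub>v y"
      unfolding S11x using car by (simp add: mult_add_distrib_mat_vec[of P1 d l1])
    also have "\<dots> = P1 *\<^sub>v a + (P1 * Mbar + P2) *\<^sub>v y"
      using car by (simp add: add_mult_distrib_mat_vec[of _ d c] assoc_mult_mat_vec[of _ d l1]
          assoc_add_vec[of _ d])
    finally show ?thesis ..
  qed
  also have "(a + Mbar *\<^sub>v y) @\<^sub>v (P1 * S11 + P2 * C12) *\<^sub>v x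
      = (S11 @\<^sub>r (P1 * S11 + P2 * C12)) *\<^sub>v x"
    using mat_mult_append[of S11 l1 n "P1 * S11 + P2 * C12" d x] car by (simp add: S11x)
  finally show ?thesis
    by (simp add: a_def y_def)
qed

section \<open>The filter theorem\<close>

theorem theorem1:
  fixes m n k r q s l p n0 q1 r1 l1 :: nat
    and E A B C D Dxib F G H K :: rmat
    and X :: "rvec set" and g :: "rvec \<Rightarrow> real \<Rightarrow> rvec"
    and W11 W12 W22 :: rmat
    and P E1 Dxi F1 A1 A2 B1 B2 D1 D2 C1 G1 U V C11 C12 D11 D12 \<Phi> :: rmat
    and S11 P1 P2 Q :: rmat
    and N T L Mbar :: rmat
    and S :: descriptor_system and Fl :: filter_data
    and \<gamma> :: real
  \<comment> \<open>the system\<close>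
  assumes "E \<in> carrier_mat m n" "A \<in> carrier_mat m n" "B \<in> carrier_mat m k"
    "C \<in> carrier_mat r n" "D \<in> carrier_mat m q" "Dxib \<in> carrier_mat m s"
    "F \<in> carrier_mat m l" "G \<in> carrier_mat r q" "H \<in> carrier_mat l p" "K \<in> carrier_mat p n"
    and "open_in_Rn p X"
    and S_eq: "S = \<lparr>sE = E, sA = A, sB = B, sC = C, sD = D, sDxi = Dxib, sF = F, sG = G,
                    sH = H, sK = K, sX = X, sg = g\<rparr>"
    and "C1_map l l (nonlin_domain S) g"
    and "\<exists>I x u v \<xi> y z. system_solution S I x u v \<xi> y z"
    and "functional_unique S"
  \<comment> \<open>the transformation\<close>
    and "n0 = matrix_rank (E @\<^sub>c Dxib @\<^sub>c F)" "n0 \<le> n"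
    and "P \<in> carrier_mat m m" "invertible_mat P"
    and "E1 \<in> carrier_mat n0 n" "Dxi \<in> carrier_mat n0 s" "F1 \<in> carrier_mat n0 l"
    and "P * (E @\<^sub>c Dxib @\<^sub>c F) = (E1 @\<^sub>c Dxi @\<^sub>c F1) @\<^sub>r 0\<^sub>m (m - n0) (n + s + l)"
    and "matrix_rank (E1 @\<^sub>c Dxi @\<^sub>c F1) = n0"
    and "A1 \<in> carrier_mat n0 n" "A2 \<in> carrier_mat (m - n0) n" "P * A = A1 @\<^sub>r A2"
    and "B1 \<in> carrier_mat n0 k" "B2 \<in> carrier_mat (m - n0) k" "P * B = B1 @\<^sub>r B2"
    and "D1 \<in> carrier_mat n0 q" "D2 \<in> carrier_mat (m - n0) q" "P * D = D1 @\<^sub>r D2"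
    and "C1 = A2 @\<^sub>r C" "G1 = D2 @\<^sub>r G" "r1 = m + r - n0" "q1 = matrix_rank G1"
    and "U \<in> carrier_mat r1 r1" "invertible_mat U"
    and "V \<in> carrier_mat q q" "invertible_mat V"
    and "U * G1 * V = four_block_mat (1\<^sub>m q1) (0\<^sub>m q1 (q - q1))
                                     (0\<^sub>m (r1 - q1) q1) (0\<^sub>m (r1 - q1) (q - q1))"
    and "C11 \<in> carrier_mat q1 n" "C12 \<in> carrier_mat (r1 - q1) n" "U * C1 = C11 @\<^sub>r C12"
    and "D11 \<in> carrier_mat n0 q1" "D12 \<in> carrier_mat n0 (q - q1)" "D1 * V = D11 @\<^sub>c D12"
    and "\<Phi> = A1 - D11 * C11"
  \<comment> \<open>the decomposition of the functional\<close>
    and "S11 \<in> carrier_mat l1 n" "l1 \<le> p"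
    and "P1 \<in> carrier_mat (p - l1) l1" "P2 \<in> carrier_mat (p - l1) (r1 - q1)"
    and "if matrix_rank (C12 @\<^sub>r K) \<noteq> matrix_rank C12 + matrix_rank K
         then permutation_matrix p Q \<and> matrix_rank S11 = l1 \<and>
              row_space_of S11 \<inter> row_space_of C12 = {0\<^sub>v n} \<and>
              row_space_of S11 \<subseteq> row_space_of K \<and>
              K = Q * (S11 @\<^sub>r (P1 * S11 + P2 * C12))
         else S11 = K \<and> Q = 1\<^sub>m p \<and> l1 = p"
  \<comment> \<open>the filter\<close>
    and "N \<in> carrier_mat l1 l1" "T \<in> carrier_mat l1 n0"
    and "L \<in> carrier_mat l1 (r1 - q1)" "Mbar \<in> carrier_mat l1 (r1 - q1)"
    and Fl_eq: "Fl = \<lparr>fN = N, fT = T, fL = L, fMbar = Mbar, fB1 = B1, fB2 = B2, fD11 = D11,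
                      fF1 = F1, fU = U, fQ = Q, fP1 = P1, fP2 = P2\<rparr>"
  \<comment> \<open>incremental quadratic constraint and rank condition\<close>
    and "W11 \<in> carrier_mat l l" "W12 \<in> carrier_mat l l" "W22 \<in> carrier_mat l l"
    and "W11\<^sup>T = W11" "W22\<^sup>T = W22"
    and "incremental_QC g (nonlin_domain S) (four_block_mat W11 W12 (W12\<^sup>T) W22)"
    and "matrix_rank (Psi_mat S) = matrix_rank (Omega_mat S)"
  \<comment> \<open>condition 1\<close>
    and "T * \<Phi> - L * C12 - N * T * E1 = 0\<^sub>m l1 n"
    and "T * E1 + Mbar * C12 - S11 = 0\<^sub>m l1 n"
    and "T * D12 = 0\<^sub>m l1 (q - q1)"
  \<comment> \<open>condition 2; a corresponding filter solution is presupposed only for nonzero disturbances\<close>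
    and "\<gamma> > 0"
    and "\<And>I x u v \<xi> y z.
           \<lbrakk>system_solution S I x u v \<xi> y z; \<not> (\<forall>t\<in>I. \<xi> t = 0\<^sub>v s)\<rbrakk>
           \<Longrightarrow> \<exists>w zh. filter_solution S Fl I u y w zh"
    and "\<And>I x u v \<xi> y z w zh e1 e.
           \<lbrakk>system_solution S I x u v \<xi> y z; filter_solution S Fl I u y w zh;
            e1 = (\<lambda>t. (T * E1) *\<^sub>v x t - w t); e = (\<lambda>t. z t - zh t)\<rbrakk>
           \<Longrightarrow> (\<forall>t\<in>I.
                  vec_deriv e1 t = N *\<^sub>v e1 t + (T * Dxi) *\<^sub>v \<xi> t
                    + (T * F1) *\<^sub>v (g (H *\<^sub>v z t) t - g (H *\<^sub>v zh t) t) \<and>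
                  e t = (Q * R_mat Fl) *\<^sub>v e1 t) \<and>
               ((\<forall>t\<in>I. \<xi> t = 0\<^sub>v s) \<longrightarrow> tends_to_zero I e) \<and>
               (\<not> (\<forall>t\<in>I. \<xi> t = 0\<^sub>v s) \<longrightarrow> (\<exists>\<beta>\<ge>0. attenuated I \<gamma> \<beta> \<xi> e))"
  shows "functional_Hinf_filter S Fl"
proof -
  note car = assms(1-10,18,20-22,25,26,28,29,31,32,38,40,43,44,46,47,50,52,53,55-58)
  note PE = assms(23) and UGV = assms(42)

  have n0_le: "n0 \<le> m"
    using arg_cong[OF PE, of dim_row] car by (simp add: append_rows_def append_cols_def)
  have q1_le: "q1 \<le> r1" "q1 \<le> q"
    using arg_cong[OF UGV, of dim_row] arg_cong[OF UGV, of dim_col] car by auto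
  have r1_eq: "m - n0 + r = r1"
    using n0_le \<open>r1 = m + r - n0\<close> by simp
  have C1: "C1 \<in> carrier_mat r1 n" and G1: "G1 \<in> carrier_mat r1 q"
    using carrier_append_rows[of A2 "m - n0" n C r] carrier_append_rows[of D2 "m - n0" q G r]
      car r1_eq \<open>C1 = A2 @\<^sub>r C\<close> \<open>G1 = D2 @\<^sub>r G\<close> by auto
  have TE1: "T * E1 \<in> carrier_mat l1 n"
    using car by simp

  have split: "T * E1 + Mbar * C12 = S11"
  proof (rule eq_matI)
    fix i j assume "i < dim_row S11" "j < dim_col S11"
    then show "(T * E1 + Mbar * C12) $$ (i, j) = S11 $$ (i, j)"
      using arg_cong[OF assms(68), of "\<lambda>X. X $$ (i, j)"] car by (simp del: index_mult_mat(1))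
  qed (use car in auto)

  \<comment> \<open>In the second case the lower block of the stacked matrix has \<open>p - l1 = 0\<close> rows, so both
    cases of the decomposition of \<open>K\<close> obey the same formula.\<close>
  have Q: "Q \<in> carrier_mat p p" and K_eq: "K = Q * (S11 @\<^sub>r (P1 * S11 + P2 * C12))"
  proof -
    have "Q \<in> carrier_mat p p \<and> K = Q * (S11 @\<^sub>r (P1 * S11 + P2 * C12))"
    proof (cases "matrix_rank (C12 @\<^sub>r K) \<noteq> matrix_rank C12 + matrix_rank K")
      case True
      then show ?thesis
        using assms(54) by (auto simp: permutation_matrix_def)
    next
      case False
      then have eqs: "S11 = K" "Q = 1\<^sub>m p" "l1 = p"
        using assms(54) by auto
      have "S11 @\<^sub>r (P1 * S11 + P2 * C12) = S11"
        using car eqs by (intro eq_matI) (auto simp: append_rows_def)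
      then show ?thesis
        using eqs \<open>K \<in> carrier_mat p n\<close> by simp
    qed
    then show "Q \<in> carrier_mat p p" "K = Q * (S11 @\<^sub>r (P1 * S11 + P2 * C12))"
      by auto
  qed

  \<comment> \<open>Without disturbance the filter admits the trajectory on which both \<open>e1\<close> and \<open>e\<close> vanish. As
    \<open>zh = z\<close> there, its continuity and the membership of \<open>H zh\<close> in the domain of \<open>g\<close> are inherited
    from the solution of the system.\<close>
  have exact_filter: "filter_solution S Fl I u y (\<lambda>t. (T * E1) *\<^sub>v x t) z"
    if sol: "system_solution S I x u v \<xi> y z" and \<xi>0: "\<forall>t\<in>I. \<xi> t = 0\<^sub>v s"
    for I x u v \<xi> y z
  proof -
    have I: "open I" and x_C1: "vec_C1_on n I x" and z_cont: "vec_continuous_on p I z"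
      using sol car by (auto simp: system_solution_def S_eq)
    have
      "H *\<^sub>v z t \<in> nonlin_domain S \<and>
       vec_deriv (\<lambda>t. (T * E1) *\<^sub>v x t) t =
         N *\<^sub>v ((T * E1) *\<^sub>v x t) + (T * B1) *\<^sub>v u t + (T * D11) *\<^sub>v y1_of Fl (u t) (y t)
         + L *\<^sub>v y2_of Fl (u t) (y t) + (T * F1) *\<^sub>v g (H *\<^sub>v z t) t \<and>
       z t = Q *\<^sub>v (R_mat Fl *\<^sub>v ((T * E1) *\<^sub>v x t) + M_mat Fl *\<^sub>v y2_of Fl (u t) (y t))"
      if t: "t \<in> I" for t
    proof -
      have x: "x t \<in> carrier_vec n" and u: "u t \<in> carrier_vec k" and v: "v t \<in> carrier_vec q"
        using sol t car
        by (auto simp: system_solution_def S_eq vec_C1_on_def vec_continuous_on_def)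
      have dx: "vec_deriv x t \<in> carrier_vec n"
        by (rule vec_deriv_carrier[of x, OF x])
      define h where "h = g (H *\<^sub>v z t) t"
      have z: "z t = K *\<^sub>v x t" and y: "y t = C *\<^sub>v x t + G *\<^sub>v v t"
        and dom: "H *\<^sub>v z t \<in> nonlin_domain S"
        and dyn: "E *\<^sub>v vec_deriv x t =
          A *\<^sub>v x t + B *\<^sub>v u t + D *\<^sub>v v t + Dxib *\<^sub>v 0\<^sub>v s + F *\<^sub>v h"
        using sol t \<xi>0 by (auto simp: system_solution_def S_eq h_def)
      have h: "h \<in> carrier_vec l"
        using assms(13) dom by (simp add: C1_map_def h_def)
      note transformed = transformed_dynamics[OF assms(1-3,5-7,18,20-22,25,28,31,26,29,32) PE
          assms(27,30,33) x dx u v zero_carrier_vec h dyn]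
      have reduced: "E1 *\<^sub>v vec_deriv x t =
          A1 *\<^sub>v x t + B1 *\<^sub>v u t + D1 *\<^sub>v v t + Dxi *\<^sub>v 0\<^sub>v s + F1 *\<^sub>v h"
        by (rule transformed(1))
      have constraint: "- (B2 *\<^sub>v u t) = A2 *\<^sub>v x t + D2 *\<^sub>v v t"
        by (rule transformed(2))
      \<comment> \<open>coordinates of the unknown input in which the output map is normalised\<close>
      obtain v' where v': "v' \<in> carrier_vec q" "v t = V *\<^sub>v v'"
        using invertible_mat_mult_vec_surj[OF assms(40,41) v] .
      define v1 where "v1 = vec_first v' q1"
      define v2 where "v2 = vec_last v' (q - q1)"
      have v1: "v1 \<in> carrier_vec q1" and v2: "v2 \<in> carrier_vec (q - q1)"
        by (simp_all add: v1_def v2_def)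
      have v_eq: "v t = V *\<^sub>v (v1 @\<^sub>v v2)"
        using v' q1_le unfolding v1_def v2_def by (subst vec_first_last_append) auto
      have "- (B2 *\<^sub>v u t) @\<^sub>v y t = C1 *\<^sub>v x t + G1 *\<^sub>v (V *\<^sub>v (v1 @\<^sub>v v2))"
      proof -
        have "C1 *\<^sub>v x t + G1 *\<^sub>v v t =
            (A2 *\<^sub>v x t @\<^sub>v C *\<^sub>v x t) + (D2 *\<^sub>v v t @\<^sub>v G *\<^sub>v v t)"
          using mat_mult_append[of A2 "m - n0" n C r "x t"]
            mat_mult_append[of D2 "m - n0" q G r "v t"] car x v
          by (simp add: \<open>C1 = A2 @\<^sub>r C\<close> \<open>G1 = D2 @\<^sub>r G\<close>)
        also have "\<dots> = (A2 *\<^sub>v x t + D2 *\<^sub>v v t) @\<^sub>v (C *\<^sub>v x t + G *\<^sub>v v t)"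
          by (rule append_vec_add[where n = "m - n0" and m = r]) (use car x v in auto)
        finally show ?thesis
          by (simp add: constraint y flip: v_eq)
      qed
      then have "Uy Fl (u t) (y t) = (C11 *\<^sub>v x t + v1) @\<^sub>v C12 *\<^sub>v x t"
        unfolding Uy_def Fl_eq
        using transformed_output[OF C1 G1 assms(38,40) UGV assms(43-45) x v1 v2] q1_le by simp
      then have y1: "y1_of Fl (u t) (y t) = C11 *\<^sub>v x t + v1"
        and y2: "y2_of Fl (u t) (y t) = C12 *\<^sub>v x t"
        using vec_first_append[of "C11 *\<^sub>v x t + v1" q1]
          vec_last_append[of "C12 *\<^sub>v x t" "r1 - q1"] car x v1
        by (auto simp: y1_of_def y2_of_def Fl_eq)
      \<comment> \<open>the part of the dynamics that the filter copies verbatim\<close>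
      define f where "f = B1 *\<^sub>v u t + F1 *\<^sub>v h"
      have f: "f \<in> carrier_vec n0"
        using car u h by (auto simp: f_def)
      have Tf: "T *\<^sub>v f = (T * B1) *\<^sub>v u t + (T * F1) *\<^sub>v h"
        using car u h
        by (simp add: f_def mult_add_distrib_mat_vec[of T l1 n0] assoc_mult_mat_vec[of T l1 n0])
      have "vec_deriv (\<lambda>t. (T * E1) *\<^sub>v x t) t = T *\<^sub>v (E1 *\<^sub>v vec_deriv x t)"
        using vec_deriv_mult_mat[OF TE1 x_C1 I t] car dx
        by (simp add: assoc_mult_mat_vec[of T l1 n0])
      also have "E1 *\<^sub>v vec_deriv x t = A1 *\<^sub>v x t + D1 *\<^sub>v (V *\<^sub>v (v1 @\<^sub>v v2)) + f"
        unfolding reduced f_def v_eq[symmetric]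
        using car x u v h by (intro eq_vecI) auto
      also have "T *\<^sub>v \<dots> = N *\<^sub>v ((T * E1) *\<^sub>v x t) + (T * D11) *\<^sub>v (C11 *\<^sub>v x t + v1)
          + L *\<^sub>v (C12 *\<^sub>v x t) + T *\<^sub>v f"
        by (rule projected_dynamics[where q = q and b = "q - q1"])
          (use car x v1 v2 f q1_le assms(48,67,69) in \<open>auto simp: \<open>\<Phi> = A1 - D11 * C11\<close>\<close>)
      also have "\<dots> = N *\<^sub>v ((T * E1) *\<^sub>v x t) + (T * B1) *\<^sub>v u t
          + (T * D11) *\<^sub>v y1_of Fl (u t) (y t) + L *\<^sub>v y2_of Fl (u t) (y t) + (T * F1) *\<^sub>v h"
        unfolding Tf y1 y2 using car by (intro eq_vecI) (auto simp del: index_mult_mat_vec)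
      finally have deriv: "vec_deriv (\<lambda>t. (T * E1) *\<^sub>v x t) t = \<dots>" .
      have "Q *\<^sub>v (R_mat Fl *\<^sub>v ((T * E1) *\<^sub>v x t) + M_mat Fl *\<^sub>v y2_of Fl (u t) (y t))
          = Q *\<^sub>v ((S11 @\<^sub>r (P1 * S11 + P2 * C12)) *\<^sub>v x t)"
        using functional_reconstruction[OF assms(50,44) TE1 assms(58,52,53) x split] car
        by (simp add: R_mat_def M_mat_def Fl_eq y2[unfolded Fl_eq])
      also have "\<dots> = K *\<^sub>v x t"
        unfolding K_eq
        by (rule assoc_mult_mat_vec[OF Q _ x, symmetric])
          (use carrier_append_rows[of S11 l1 n "P1 * S11 + P2 * C12" "p - l1"] car \<open>l1 \<le> p\<close> in auto)
      finally show ?thesis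
        using z dom deriv by (simp add: h_def)
    qed
    moreover have fields: "sH S = H" "sg S = g" "dim_row (sK S) = p" "dim_row (fN Fl) = l1"
      "fN Fl = N" "fT Fl = T" "fB1 Fl = B1" "fD11 Fl = D11" "fL Fl = L" "fF1 Fl = F1" "fQ Fl = Q"
      using car by (simp_all add: S_eq Fl_eq)
    ultimately show ?thesis
      unfolding filter_solution_def fields
      using vec_C1_on_mult_mat[OF TE1 x_C1 I] z_cont by blast
  qed

  have s: "dim_col (sDxi S) = s"
    using car by (simp add: S_eq)
  show ?thesis
    unfolding functional_Hinf_filter_def s
  proof (rule exI[of _ \<gamma>], intro conjI allI impI \<open>\<gamma> > 0\<close>)
    fix I x u v \<xi> y z
    assume sol: "system_solution S I x u v \<xi> y z"
    then show "\<exists>w zh. filter_solution S Fl I u y w zh"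
      using exact_filter assms(71) by blast
    fix w zh assume "filter_solution S Fl I u y w zh"
    note error = assms(72)[OF sol this refl refl]
    show "tends_to_zero I (\<lambda>t. z t - zh t)" if "\<forall>t\<in>I. \<xi> t = 0\<^sub>v s"
      using error that by blast
    show "\<exists>\<beta>\<ge>0. attenuated I \<gamma> \<beta> \<xi> (\<lambda>t. z t - zh t)" if "\<not> (\<forall>t\<in>I. \<xi> t = 0\<^sub>v s)"
      using error that by blast
  qed
qed

end
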